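(* Let $X$ be a set and $R\subseteq X\times X$. Then, with the left and right closure operations $\mathrm{lcl}$, $\mathrm{rcl}$ taken in the space $\beta X\times\beta X$ with the product topology, $$\widetilde R=\mathrm{rcl}(\mathrm{lcl}\,R)\qquad\text{and}\qquad(\widetilde{R^{-1}})^{-1}=\mathrm{lcl}(\mathrm{rcl}\,R).$$
   Context: $\beta X$ denotes the set of ultrafilters over $X$, with the topology generated by the sets $\{u\in\beta X:S\in u\}$ for $S\subseteq X$; $\beta X\times\beta X$ has the product topology, with closure operation $\mathrm{cl}$. $X$ is identified with the set of principal ultrafilters in $\beta X$, so $R\subseteq X\times X\subseteq\beta X\times\beta X$. For $R\subseteq X\times X$ and $u,v\in\beta X$, $$\widetilde R(u,v)\iff\{x:\{y:R(x,y)\}\in v\}\in u.$$ For $Q\subseteq\beta X\times\beta X$ and $u,v\in\beta X$, the left and right sections are $Q^{(u)}=Q\cap(\{u\}\times\beta X)$ and $Q_{(v)}=Q\cap(\beta X\times\{v\})$, and the left and right closures are $$\mathrm{lcl}\,Q=\bigcup_{u\in\beta X}\mathrm{cl}\,Q^{(u)},\qquad\mathrm{rcl}\,Q=\bigcup_{v\in\beta X}\mathrm{cl}\,Q_{(v)}.$$ For a relation $Q$, $Q^{-1}=\{(b,a):(a,b)\in Q\}$. *)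

theory Defs
  imports "HOL-Analysis.Analysis"
begin

definition ultrafilter_on :: "'a set \<Rightarrow> 'a set set \<Rightarrow> bool" where
  "ultrafilter_on X u \<longleftrightarrow>
     u \<subseteq> Pow X \<and> X \<in> u \<and> {} \<notin> u \<and>
     (\<forall>A\<in>u. \<forall>B\<in>u. A \<inter> B \<in> u) \<and>
     (\<forall>A\<in>u. \<forall>B. A \<subseteq> B \<and> B \<subseteq> X \<longrightarrow> B \<in> u) \<and>
     (\<forall>A. A \<subseteq> X \<longrightarrow> A \<in> u \<or> X - A \<in> u)"

definition beta :: "'a set \<Rightarrow> 'a set set set" where
  "beta X = {u. ultrafilter_on X u}"

definition beta_topology :: "'a set \<Rightarrow> 'a set set topology" where
  "beta_topology X = topology_generated_by {{u \<in> beta X. S \<in> u} |S. S \<subseteq> X}"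

definition principal_uf :: "'a set \<Rightarrow> 'a \<Rightarrow> 'a set set" where
  "principal_uf X x = {S. S \<subseteq> X \<and> x \<in> S}"

text \<open>The embedding of \<open>X\<close> into \<open>beta X\<close>, applied to relations; it makes explicit the
  identification of points with principal ultrafilters.\<close>

definition rel_embed :: "'a set \<Rightarrow> ('a \<times> 'a) set \<Rightarrow> ('a set set \<times> 'a set set) set" where
  "rel_embed X R = {(principal_uf X x, principal_uf X y) |x y. (x, y) \<in> R}"

definition rel_tilde :: "'a set \<Rightarrow> ('a \<times> 'a) set \<Rightarrow> ('a set set \<times> 'a set set) set" where
  "rel_tilde X R =
     {(u, v). u \<in> beta X \<and> v \<in> beta X \<and> {x \<in> X. {y \<in> X. (x, y) \<in> R} \<in> v} \<in> u}"

definition left_section ::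
  "'a set \<Rightarrow> ('a set set \<times> 'a set set) set \<Rightarrow> 'a set set \<Rightarrow> ('a set set \<times> 'a set set) set" where
  "left_section X Q u = Q \<inter> ({u} \<times> beta X)"

definition right_section ::
  "'a set \<Rightarrow> ('a set set \<times> 'a set set) set \<Rightarrow> 'a set set \<Rightarrow> ('a set set \<times> 'a set set) set" where
  "right_section X Q v = Q \<inter> (beta X \<times> {v})"

definition lcl ::
  "'a set \<Rightarrow> ('a set set \<times> 'a set set) set \<Rightarrow> ('a set set \<times> 'a set set) set" where
  "lcl X Q =
     (\<Union>u\<in>beta X. prod_topology (beta_topology X) (beta_topology X) closure_of left_section X Q u)"

definition rcl ::
  "'a set \<Rightarrow> ('a set set \<times> 'a set set) set \<Rightarrow> ('a set set \<times> 'a set set) set" where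
  "rcl X Q =
     (\<Union>v\<in>beta X. prod_topology (beta_topology X) (beta_topology X) closure_of right_section X Q v)"

lemma topspace_beta_topology [simp]: "topspace (beta_topology X) = beta X"
  unfolding beta_topology_def topology_generated_by_topspace
  by (auto simp: beta_def ultrafilter_on_def)

lemma principal_uf_in_beta: "x \<in> X \<Longrightarrow> principal_uf X x \<in> beta X"
  by (auto simp: beta_def ultrafilter_on_def principal_uf_def)

lemma inj_on_principal_uf: "inj_on (principal_uf X) X"
proof (rule inj_onI)
  fix x y assume "x \<in> X" "y \<in> X" and eq: "principal_uf X x = principal_uf X y"
  from \<open>x \<in> X\<close> have "{x} \<in> principal_uf X x" by (simp add: principal_uf_def)
  then have "{x} \<in> principal_uf X y" by (simp only: eq)
  then show "x = y" by (simp add: principal_uf_def)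
qed

end

theory Submission
  imports Defs
begin

text \<open>
  The closure in \<open>beta X\<close> of a set \<open>A\<close> of principal ultrafilters is
  \<open>{u. A \<in> u}\<close> (lemma \<open>closure_of_principal_image\<close>). Since points of \<open>beta X\<close> are closed, the
  closure of a section \<open>{u} \<times> T\<close> in the product is \<open>{u} \<times> cl T\<close>; hence \<open>lcl\<close> and \<open>rcl\<close> take
  closures in one coordinate while fixing the other (lemmas \<open>lcl_eq\<close> and \<open>rcl_eq\<close>). The left
  closure of \<open>R\<close> therefore consists of the pairs \<open>(x, v)\<close> with \<open>x\<close> principal and
  \<open>{y. R x y} \<in> v\<close>. For fixed \<open>v\<close> its section is again a set of principal ultrafilters, and closing
  it gives exactly the pairs \<open>(u, v)\<close> with \<open>{x. {y. R x y} \<in> v} \<in> u\<close>. The second identity is the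
  first one for \<open>R\<inverse>\<close>, because taking converses exchanges \<open>lcl\<close> and \<open>rcl\<close>.
\<close>

lemma mem_betaD:
  assumes "u \<in> beta X"
  shows "\<And>A. A \<in> u \<Longrightarrow> A \<subseteq> X" and "X \<in> u" and "{} \<notin> u"
    and "\<And>A B. A \<in> u \<Longrightarrow> B \<in> u \<Longrightarrow> A \<inter> B \<in> u"
    and "\<And>A. A \<subseteq> X \<Longrightarrow> A \<notin> u \<Longrightarrow> X - A \<in> u"
    and "\<And>A B. A \<in> u \<Longrightarrow> A \<subseteq> B \<Longrightarrow> B \<subseteq> X \<Longrightarrow> B \<in> u"
  using assms unfolding beta_def ultrafilter_on_def mem_Collect_eq
  by (meson PowD subsetD)+

lemma beta_Diff_mem_iff:
  assumes "u \<in> beta X" "A \<subseteq> X"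
  shows "X - A \<in> u \<longleftrightarrow> A \<notin> u"
proof
  assume "X - A \<in> u"
  show "A \<notin> u"
  proof
    assume "A \<in> u"
    from mem_betaD(4)[OF assms(1) this \<open>X - A \<in> u\<close>] mem_betaD(3)[OF assms(1)]
    show False by simp
  qed
qed (rule mem_betaD(5)[OF assms])

lemma openin_beta_basic: "S \<subseteq> X \<Longrightarrow> openin (beta_topology X) {u \<in> beta X. S \<in> u}"
  unfolding beta_topology_def by (rule topology_generated_by_Basis) blast

lemma closedin_beta_basic:
  assumes "S \<subseteq> X"
  shows "closedin (beta_topology X) {u \<in> beta X. S \<in> u}"
proof -
  have "beta X - {u \<in> beta X. S \<in> u} = {u \<in> beta X. X - S \<in> u}"
    using assms beta_Diff_mem_iff by blast
  then show ?thesis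
    by (simp add: closedin_def openin_beta_basic)
qed

text \<open>The generating sets form a base, as ultrafilters are closed under intersection.\<close>

lemma openin_beta_basic_nbhd:
  assumes "openin (beta_topology X) U" "u \<in> U"
  obtains S where "S \<in> u" "{w \<in> beta X. S \<in> w} \<subseteq> U"
proof -
  have u: "u \<in> beta X"
    using openin_subset[OF assms(1)] assms(2) by auto
  from assms have "generate_topology_on {{u \<in> beta X. S \<in> u} |S. S \<subseteq> X} U"
    unfolding beta_topology_def by (simp add: openin_topology_generated_by_iff)
  then have "u \<in> U \<longrightarrow> (\<exists>S\<in>u. {w \<in> beta X. S \<in> w} \<subseteq> U)"
  proof induction
    case Empty
    then show ?case by simp
  next
    case (Int A B)
    show ?case
    proof
      assume "u \<in> A \<inter> B"
      with Int obtain S T where ST: "S \<in> u" "{w \<in> beta X. S \<in> w} \<subseteq> A"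
          "T \<in> u" "{w \<in> beta X. T \<in> w} \<subseteq> B" by blast
      have "S \<in> w \<and> T \<in> w" if w: "w \<in> beta X" "S \<inter> T \<in> w" for w
        using mem_betaD(6)[OF w(1,2)] mem_betaD(1)[OF u ST(1)] mem_betaD(1)[OF u ST(3)] by simp
      then show "\<exists>S\<in>u. {w \<in> beta X. S \<in> w} \<subseteq> A \<inter> B"
        using ST mem_betaD(4)[OF u ST(1,3)] by blast
    qed
  next
    case (UN K)
    then show ?case by (meson Sup_upper UnionE order_trans)
  next
    case (Basis s)
    then show ?case by blast
  qed
  with assms(2) that show thesis by blast
qed

lemma closure_of_principal_image:
  assumes "A \<subseteq> X"
  shows "beta_topology X closure_of (principal_uf X ` A) = {u \<in> beta X. A \<in> u}"
proof
  have "principal_uf X ` A \<subseteq> {u \<in> beta X. A \<in> u}"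
    using assms by (auto intro!: principal_uf_in_beta) (auto simp: principal_uf_def)
  then show "beta_topology X closure_of (principal_uf X ` A) \<subseteq> {u \<in> beta X. A \<in> u}"
    using closure_of_minimal closedin_beta_basic[OF assms] by blast
next
  show "{u \<in> beta X. A \<in> u} \<subseteq> beta_topology X closure_of (principal_uf X ` A)"
  proof clarify
    fix u assume u: "u \<in> beta X" "A \<in> u"
    show "u \<in> beta_topology X closure_of (principal_uf X ` A)"
      unfolding in_closure_of topspace_beta_topology
    proof (intro conjI u(1) allI impI)
      fix U assume "u \<in> U \<and> openin (beta_topology X) U"
      then obtain S where S: "S \<in> u" "{w \<in> beta X. S \<in> w} \<subseteq> U"
        using openin_beta_basic_nbhd[of X U u] by metis
      have "S \<inter> A \<noteq> {}"
        using mem_betaD(3,4)[OF u(1)] S(1) u(2) by metis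
      then obtain x where x: "x \<in> S" "x \<in> A" by blast
      have "S \<in> principal_uf X x"
        using x(1) mem_betaD(1)[OF u(1) S(1)] by (simp add: principal_uf_def)
      then show "\<exists>y. y \<in> principal_uf X ` A \<and> y \<in> U"
        using x(2) assms S(2) principal_uf_in_beta[of x X] by auto
    qed
  qed
qed

lemma closure_of_beta_singleton:
  assumes "u \<in> beta X"
  shows "beta_topology X closure_of {u} = {u}"
proof
  show "beta_topology X closure_of {u} \<subseteq> {u}"
  proof
    fix w assume "w \<in> beta_topology X closure_of {u}"
    then have w: "w \<in> beta X" "\<And>U. w \<in> U \<Longrightarrow> openin (beta_topology X) U \<Longrightarrow> u \<in> U"
      by (auto simp: in_closure_of)
    have "w \<subseteq> u"
    proof
      fix S assume "S \<in> w"
      with w(1) have "w \<in> {u \<in> beta X. S \<in> u}" "S \<subseteq> X"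
        using mem_betaD(1) by auto
      with w(2) have "u \<in> {u \<in> beta X. S \<in> u}"
        using openin_beta_basic[of S X] by presburger
      then show "S \<in> u" by simp
    qed
    \<comment> \<open>An ultrafilter is maximal: a set in \<open>u\<close> but not in \<open>w\<close> would have its complement in \<open>w \<subseteq> u\<close>.\<close>
    moreover have "u \<subseteq> w"
    proof
      fix S assume "S \<in> u"
      then have "S \<subseteq> X" "X - S \<notin> u"
        using mem_betaD(1)[OF assms] beta_Diff_mem_iff[OF assms] by simp_all
      then show "S \<in> w"
        using \<open>w \<subseteq> u\<close> mem_betaD(5)[OF w(1)] by blast
    qed
    ultimately show "w \<in> {u}" by blast
  qed
qed (use closure_of_subset[of "{u}" "beta_topology X"] assms in simp)

lemma lcl_eq:
  "lcl X Q = {(u, v). u \<in> beta X \<and> v \<in> beta_topology X closure_of {v \<in> beta X. (u, v) \<in> Q}}"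
proof -
  have "left_section X Q u = {u} \<times> {v \<in> beta X. (u, v) \<in> Q}" for u
    by (auto simp: left_section_def)
  then show ?thesis
    unfolding lcl_def by (auto simp: closure_of_Times closure_of_beta_singleton)
qed

lemma rcl_eq:
  "rcl X Q = {(u, v). v \<in> beta X \<and> u \<in> beta_topology X closure_of {u \<in> beta X. (u, v) \<in> Q}}"
proof -
  have "right_section X Q v = {u \<in> beta X. (u, v) \<in> Q} \<times> {v}" for v
    by (auto simp: right_section_def)
  then show ?thesis
    unfolding rcl_def by (auto simp: closure_of_Times closure_of_beta_singleton)
qed

lemma converse_rcl: "(rcl X Q)\<inverse> = lcl X (Q\<inverse>)"
  by (auto simp: lcl_eq rcl_eq)

lemma converse_lcl: "(lcl X Q)\<inverse> = rcl X (Q\<inverse>)"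
  by (auto simp: lcl_eq rcl_eq)

lemma rel_embed_converse: "rel_embed X (R\<inverse>) = (rel_embed X R)\<inverse>"
  by (auto simp: rel_embed_def)

lemma lcl_rel_embed:
  assumes "R \<subseteq> X \<times> X"
  shows "lcl X (rel_embed X R) =
    {(principal_uf X x, v) |x v. x \<in> X \<and> v \<in> beta X \<and> {y \<in> X. (x, y) \<in> R} \<in> v}"
    (is "_ = ?L")
proof -
  have fibre: "beta_topology X closure_of {v \<in> beta X. (principal_uf X x, v) \<in> rel_embed X R} =
      {v \<in> beta X. {y \<in> X. (x, y) \<in> R} \<in> v}" if x: "x \<in> X" for x
  proof -
    have "x' = x" if "principal_uf X x = principal_uf X x'" "x' \<in> X" for x'
      using inj_onD[OF inj_on_principal_uf that(1) x that(2)] by simp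
    then have "{v \<in> beta X. (principal_uf X x, v) \<in> rel_embed X R} =
        principal_uf X ` {y \<in> X. (x, y) \<in> R}"
      using assms by (auto 0 3 simp: rel_embed_def intro: principal_uf_in_beta)
    then show ?thesis by (simp add: closure_of_principal_image)
  qed
  \<comment> \<open>The section at a nonprincipal ultrafilter is empty.\<close>
  have principal: "u \<in> principal_uf X ` X" if "(u, v) \<in> lcl X (rel_embed X R)" for u v
  proof (rule ccontr)
    assume "u \<notin> principal_uf X ` X"
    then have "{v \<in> beta X. (u, v) \<in> rel_embed X R} = {}"
      using assms by (auto simp: rel_embed_def)
    with that show False by (simp add: lcl_eq)
  qed
  have mem: "(principal_uf X x, v) \<in> lcl X (rel_embed X R) \<longleftrightarrow>
      v \<in> beta X \<and> {y \<in> X. (x, y) \<in> R} \<in> v" if "x \<in> X" for x v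
    using fibre[OF that] that by (simp add: lcl_eq principal_uf_in_beta)
  show ?thesis
  proof (intro equalityI subrelI)
    fix u v assume uv: "(u, v) \<in> lcl X (rel_embed X R)"
    with principal obtain x where "x \<in> X" "u = principal_uf X x" by blast
    with uv mem show "(u, v) \<in> ?L" by auto
  next
    fix u v assume "(u, v) \<in> ?L"
    with mem show "(u, v) \<in> lcl X (rel_embed X R)" by auto
  qed
qed

lemma rel_tilde_eq_rcl_lcl:
  assumes "R \<subseteq> X \<times> X"
  shows "rel_tilde X R = rcl X (lcl X (rel_embed X R))"
proof -
  have "{u \<in> beta X. (u, v) \<in> lcl X (rel_embed X R)} =
      principal_uf X ` {x \<in> X. {y \<in> X. (x, y) \<in> R} \<in> v}" if "v \<in> beta X" for v
    using that by (auto simp: lcl_rel_embed[OF assms] intro: principal_uf_in_beta)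
  then show ?thesis
    by (auto simp: rel_tilde_def rcl_eq closure_of_principal_image)
qed

theorem theorem5:
  fixes X :: "'a set" and R :: "('a \<times> 'a) set"
  assumes "R \<subseteq> X \<times> X"
  shows "rel_tilde X R = rcl X (lcl X (rel_embed X R)) \<and>
         (rel_tilde X (R\<inverse>))\<inverse> = lcl X (rcl X (rel_embed X R))"
proof
  show "rel_tilde X R = rcl X (lcl X (rel_embed X R))"
    by (rule rel_tilde_eq_rcl_lcl[OF assms])
  have "R\<inverse> \<subseteq> X \<times> X"
    using assms by blast
  then show "(rel_tilde X (R\<inverse>))\<inverse> = lcl X (rcl X (rel_embed X R))"
    by (simp add: rel_tilde_eq_rcl_lcl rel_embed_converse converse_rcl converse_lcl)
qed

end
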